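(* Let $x,y\in \mathcal{H}$. Then the following conditions are equivalent: (1) $x\parallel_A y$. (2) $x\otimes_A x \parallel_{\omega_A} y\otimes_A y$.
   Context: $\mathcal{H}$ is a complex Hilbert space with inner product $\langle\cdot\mid\cdot\rangle$ (linear in the first variable), and $A\in\mathcal{B}(\mathcal{H})$ is a nonzero positive (semi-definite) operator. Put $\langle x\mid y\rangle_A=\langle Ax\mid y\rangle$, $\|x\|_A=\langle x\mid x\rangle_A^{1/2}$, and $\mathbb{T}=\{\lambda\in\mathbb{C}:|\lambda|=1\}$. For vectors $x,y\in\mathcal{H}$, $x\parallel_A y$ means that $\|x+\lambda y\|_A=\|x\|_A+\|y\|_A$ for some $\lambda\in\mathbb{T}$. The $A$-rank one operator $x\otimes_A y:\mathcal{H}\to\mathcal{H}$ is defined by $(x\otimes_A y)(z)=\langle z\mid y\rangle_A\,x$. An operator $T\in\mathcal{B}(\mathcal{H})$ is $A$-bounded if there is $\lambda>0$ with $\|Tx\|_A\le\lambda\|x\|_A$ for all $x\in\mathcal{H}$ (the operators $x\otimes_A y$ are $A$-bounded). For $A$-bounded $T$, $\omega_A(T)=\sup\{|\langle Tx\mid x\rangle_A| : x\in\mathcal{H},\ \|x\|_A=1\}$. For $A$-bounded $T,S$, $T\parallel_{\omega_A}S$ ($A$-numerical radius parallelism) means that $\omega_A(T+\lambda S)=\omega_A(T)+\omega_A(S)$ for some $\lambda\in\mathbb{T}$. *)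

theory Defs
  imports "HOL-Analysis.Analysis"
begin

class complex_vector = real_vector +
  fixes scaleC :: "complex \<Rightarrow> 'a \<Rightarrow> 'a"  (infixr "*\<^sub>C" 75)
  assumes scaleC_add_right: "a *\<^sub>C (x + y) = a *\<^sub>C x + a *\<^sub>C y"
    and scaleC_add_left: "(a + b) *\<^sub>C x = a *\<^sub>C x + b *\<^sub>C x"
    and scaleC_scaleC: "a *\<^sub>C b *\<^sub>C x = (a * b) *\<^sub>C x"
    and scaleC_of_real: "complex_of_real r *\<^sub>C x = r *\<^sub>R x"

text \<open>
  The inner product is linear in the first and conjugate-linear in the second argument.
  Completeness and the norm topology come from \<^class>\<open>banach\<close>; the last axiom
  says that the norm is the one induced by the inner product.
\<close>

class complex_hilbert_space = complex_vector + banach +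
  fixes cinner :: "'a \<Rightarrow> 'a \<Rightarrow> complex"
  assumes cinner_commute: "cinner x y = cnj (cinner y x)"
    and cinner_add_left: "cinner (x + y) z = cinner x z + cinner y z"
    and cinner_scaleC_left: "cinner (a *\<^sub>C x) y = a * cinner x y"
    and cinner_ge_zero: "Re (cinner x x) \<ge> 0"
    and cinner_eq_zero_iff: "cinner x x = 0 \<longleftrightarrow> x = 0"
    and norm_eq_sqrt_cinner: "norm x = sqrt (Re (cinner x x))"

instantiation complex :: complex_hilbert_space
begin

definition scaleC_complex :: "complex \<Rightarrow> complex \<Rightarrow> complex"
  where "scaleC_complex a x = a * x"

definition cinner_complex :: "complex \<Rightarrow> complex \<Rightarrow> complex"
  where "cinner_complex x y = x * cnj y"

instance
proof
  fix x :: complex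
  show "norm x = sqrt (Re (cinner x x))"
    by (simp add: cinner_complex_def cmod_def power2_eq_square)
qed (simp_all add: scaleC_complex_def cinner_complex_def algebra_simps scaleR_conv_of_real)

end

definition bounded_clinear ::
    "('a::complex_hilbert_space \<Rightarrow> 'b::complex_hilbert_space) \<Rightarrow> bool"
  where "bounded_clinear T \<longleftrightarrow> bounded_linear T \<and> (\<forall>c x. T (c *\<^sub>C x) = c *\<^sub>C T x)"

definition positive_op :: "('a::complex_hilbert_space \<Rightarrow> 'a) \<Rightarrow> bool"
  where "positive_op A \<longleftrightarrow> bounded_clinear A \<and> (\<forall>x. cinner (A x) x \<in> \<real>\<^sub>\<ge>\<^sub>0)"

definition A_inner ::
    "('a::complex_hilbert_space \<Rightarrow> 'a) \<Rightarrow> 'a \<Rightarrow> 'a \<Rightarrow> complex"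
  where "A_inner A x y = cinner (A x) y"

text \<open>For positive \<open>A\<close> the number \<open>A_inner A x x\<close> is real, so \<open>Re\<close> is only a coercion.\<close>

definition A_norm :: "('a::complex_hilbert_space \<Rightarrow> 'a) \<Rightarrow> 'a \<Rightarrow> real"
  where "A_norm A x = sqrt (Re (A_inner A x x))"

definition A_parallel :: "('a::complex_hilbert_space \<Rightarrow> 'a) \<Rightarrow> 'a \<Rightarrow> 'a \<Rightarrow> bool"
  where "A_parallel A x y \<longleftrightarrow>
    (\<exists>l::complex. cmod l = 1 \<and> A_norm A (x + l *\<^sub>C y) = A_norm A x + A_norm A y)"

definition A_rank_one ::
    "('a::complex_hilbert_space \<Rightarrow> 'a) \<Rightarrow> 'a \<Rightarrow> 'a \<Rightarrow> ('a \<Rightarrow> 'a)"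
  where "A_rank_one A x y = (\<lambda>z. A_inner A z y *\<^sub>C x)"

definition A_bounded ::
    "('a::complex_hilbert_space \<Rightarrow> 'a) \<Rightarrow> ('a \<Rightarrow> 'a) \<Rightarrow> bool"
  where "A_bounded A T \<longleftrightarrow>
    bounded_clinear T \<and> (\<exists>c>0. \<forall>x. A_norm A (T x) \<le> c * A_norm A x)"

text \<open>
  The supremum is a real one. If \<open>A\<close> is positive and nonzero and \<open>T\<close> is \<open>A\<close>-bounded,
  the set is nonempty and bounded above (by the Cauchy-Schwarz inequality for \<open>A_inner A\<close>).
\<close>

definition A_numerical_radius ::
    "('a::complex_hilbert_space \<Rightarrow> 'a) \<Rightarrow> ('a \<Rightarrow> 'a) \<Rightarrow> real"
  where "A_numerical_radius A T = (SUP x\<in>{x. A_norm A x = 1}. cmod (A_inner A (T x) x))"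

text \<open>The relation is defined only between \<open>A\<close>-bounded operators, hence the first two conjuncts.\<close>

definition A_numerical_radius_parallel ::
    "('a::complex_hilbert_space \<Rightarrow> 'a) \<Rightarrow> ('a \<Rightarrow> 'a) \<Rightarrow> ('a \<Rightarrow> 'a) \<Rightarrow> bool"
  where "A_numerical_radius_parallel A T S \<longleftrightarrow>
    A_bounded A T \<and> A_bounded A S \<and>
    (\<exists>l::complex. cmod l = 1 \<and>
      A_numerical_radius A (\<lambda>z. T z + l *\<^sub>C S z)
        = A_numerical_radius A T + A_numerical_radius A S)"

end

theory Submission
  imports Defs
begin

text \<open>
  Write \<open>a\<close>, \<open>b\<close> for the \<open>A\<close>-seminorms of \<open>x\<close>, \<open>y\<close> and \<open>c = \<langle>x | y\<rangle>\<^sub>A\<close>.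
  Both conditions are equivalent to equality \<open>\<bar>c\<bar> = a b\<close> in the Cauchy-Schwarz inequality.
  For the second one, let \<open>z\<close> be an \<open>A\<close>-unit vector, \<open>p = \<langle>z | x\<rangle>\<^sub>A\<close>, \<open>q = \<langle>z | y\<rangle>\<^sub>A\<close>.
  Then \<open>\<bar>p\<bar>\<^sup>2 + \<bar>q\<bar>\<^sup>2 = \<langle>p x + q y | z\<rangle>\<^sub>A\<close> is at most the seminorm of \<open>p x + q y\<close>, and as
  \<open>\<bar>p\<bar> \<le> a\<close>, \<open>\<bar>q\<bar> \<le> b\<close> this gives \<open>(\<bar>p\<bar>\<^sup>2 + \<bar>q\<bar>\<^sup>2)\<^sup>2 \<le> a\<^sup>4 + b\<^sup>4 + 2 a b \<bar>c\<bar>\<close>, a bound that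
  does not depend on \<open>z\<close>. If the numerical radius equals \<open>a\<^sup>2 + b\<^sup>2\<close>, then \<open>a b \<le> \<bar>c\<bar>\<close>.
\<close>

section \<open>Elementary facts on the inner product\<close>

lemma cinner_add_right: "cinner x (y + z) = cinner x y + cinner x z"
  by (metis cinner_add_left cinner_commute complex_cnj_add)

lemma cinner_scaleC_right: "cinner x (k *\<^sub>C y) = cnj k * cinner x y"
  by (metis cinner_commute cinner_scaleC_left complex_cnj_mult)

lemma norm_scaleC: "norm (k *\<^sub>C x) = cmod k * norm (x::'a::complex_hilbert_space)"
proof -
  have "cinner (k *\<^sub>C x) (k *\<^sub>C x) = of_real ((cmod k)\<^sup>2) * cinner x x"
    unfolding complex_norm_square by (simp add: cinner_scaleC_left cinner_scaleC_right)
  then show ?thesis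
    unfolding norm_eq_sqrt_cinner[of "k *\<^sub>C x"] norm_eq_sqrt_cinner[of x]
    by (simp add: real_sqrt_mult)
qed

text \<open>Lets the Cauchy-Schwarz inequality for \<open>A_inner\<close> specialise to the ordinary
  inner product.\<close>

lemma positive_op_ident: "positive_op (\<lambda>x::'a::complex_hilbert_space. x)"
proof -
  have "cinner x x \<in> \<real>\<^sub>\<ge>\<^sub>0" for x :: 'a
    using cinner_commute[of x x] cinner_ge_zero[of x]
    by (simp add: complex_nonneg_Reals_iff complex_eq_iff)
  then show ?thesis
    by (simp add: positive_op_def bounded_clinear_def bounded_linear_ident)
qed

section \<open>The semi-inner product of a positive operator, and parallel vectors\<close>

context
  fixes A :: "'a::complex_hilbert_space \<Rightarrow> 'a"
  assumes pos: "positive_op A"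
begin

lemma op_add: "A (u + v) = A u + A v"
  using pos by (simp add: positive_op_def bounded_clinear_def linear_simps)

lemma op_scaleC: "A (k *\<^sub>C v) = k *\<^sub>C A v"
  using pos by (simp add: positive_op_def bounded_clinear_def)

lemma A_inner_add_left: "A_inner A (u + v) w = A_inner A u w + A_inner A v w"
  by (simp add: A_inner_def op_add cinner_add_left)

lemma A_inner_scaleC_left: "A_inner A (k *\<^sub>C u) w = k * A_inner A u w"
  by (simp add: A_inner_def op_scaleC cinner_scaleC_left)

lemma A_inner_add_right: "A_inner A w (u + v) = A_inner A w u + A_inner A w v"
  by (simp add: A_inner_def cinner_add_right)

lemma A_inner_scaleC_right: "A_inner A w (k *\<^sub>C u) = cnj k * A_inner A w u"
  by (simp add: A_inner_def cinner_scaleC_right)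

lemmas A_inner_sesquilinear =
  A_inner_add_left A_inner_add_right A_inner_scaleC_left A_inner_scaleC_right

lemma A_inner_self_nonneg: "Re (A_inner A u u) \<ge> 0" "Im (A_inner A u u) = 0"
  using pos by (simp_all add: positive_op_def A_inner_def complex_nonneg_Reals_iff)

lemma A_norm_nonneg: "A_norm A u \<ge> 0"
  by (simp add: A_norm_def A_inner_self_nonneg)

lemma A_inner_self: "A_inner A u u = of_real ((A_norm A u)\<^sup>2)"
  by (simp add: A_norm_def A_inner_self_nonneg complex_eq_iff)

text \<open>Polarization: the diagonal is real, so the cross terms at \<open>u + v\<close> match the
  imaginary parts of the two inner products, and those at \<open>u + \<i> *\<^sub>C v\<close> match
  the real parts.\<close>

lemma A_inner_commute: "A_inner A v u = cnj (A_inner A u v)"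
  using A_inner_self_nonneg(2)[of "u + v"] A_inner_self_nonneg(2)[of "u + \<i> *\<^sub>C v"]
    A_inner_self_nonneg(2)[of u] A_inner_self_nonneg(2)[of v]
  by (simp add: A_inner_sesquilinear complex_eq_iff)

lemma A_norm_add_scaleC_sq:
  "(A_norm A (u + k *\<^sub>C v))\<^sup>2
    = (A_norm A u)\<^sup>2 + (cmod k)\<^sup>2 * (A_norm A v)\<^sup>2 + 2 * Re (cnj k * A_inner A u v)"
proof -
  have "A_inner A (u + k *\<^sub>C v) (u + k *\<^sub>C v)
      = A_inner A u u + (k * cnj k) * A_inner A v v
        + (cnj k * A_inner A u v + cnj (cnj k * A_inner A u v))"
    by (simp add: A_inner_sesquilinear A_inner_commute[of v u] algebra_simps)
  then have "complex_of_real ((A_norm A (u + k *\<^sub>C v))\<^sup>2)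
      = of_real ((A_norm A u)\<^sup>2 + (cmod k)\<^sup>2 * (A_norm A v)\<^sup>2 + 2 * Re (cnj k * A_inner A u v))"
    unfolding A_inner_self complex_norm_square[symmetric] complex_add_cnj by simp
  then show ?thesis
    using of_real_eq_iff by blast
qed

lemma A_norm_scaleC: "A_norm A (k *\<^sub>C u) = cmod k * A_norm A u"
proof -
  have "A_inner A (k *\<^sub>C u) (k *\<^sub>C u) = of_real ((cmod k)\<^sup>2) * A_inner A u u"
    unfolding complex_norm_square by (simp add: A_inner_sesquilinear)
  then show ?thesis
    by (simp add: A_norm_def real_sqrt_mult)
qed

lemma A_Cauchy_Schwarz: "cmod (A_inner A u v) \<le> A_norm A u * A_norm A v"
proof -
  define c where "c = A_inner A u v"
  \<comment> \<open>This is the squared seminorm of \<open>u - t c v\<close> for real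
    \<open>t\<close>; putting the factor \<open>c\<close> into the coefficient makes the cross term
    real.\<close>
  have quad: "0 \<le> (A_norm A u)\<^sup>2 + (t * cmod c)\<^sup>2 * (A_norm A v)\<^sup>2 - 2 * t * (cmod c)\<^sup>2" for t
  proof -
    have "Re (cnj (complex_of_real (- t) * c) * c) = - t * (cmod c)\<^sup>2"
      unfolding cmod_power2 by (simp add: power2_eq_square algebra_simps)
    then show ?thesis
      using A_norm_add_scaleC_sq[of u "of_real (- t) * c" v]
        zero_le_power2[of "A_norm A (u + (of_real (- t) * c) *\<^sub>C v)"]
      by (simp add: c_def[symmetric] norm_mult power_mult_distrib)
  qed
  have "(cmod c)\<^sup>2 \<le> (A_norm A u * A_norm A v)\<^sup>2"
  proof (cases "A_norm A v = 0")
    case True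
    have "c = 0"
    proof (rule ccontr)
      assume "c \<noteq> 0"
      \<comment> \<open>With \<open>A_norm A v = 0\<close> the expression is affine in
        \<open>t\<close>, and this \<open>t\<close> gives it the negative value
        \<open>- (A_norm A u)\<^sup>2 - 2\<close>.\<close>
      then show False
        using quad[of "((A_norm A u)\<^sup>2 + 1) / (cmod c)\<^sup>2"] True
        by simp (smt (verit) zero_le_power2)
    qed
    then show ?thesis by simp
  next
    case False
    define V where "V = (A_norm A v)\<^sup>2"
    have V: "V > 0" using False by (simp add: V_def)
    \<comment> \<open>The quadratic in \<open>t\<close> is smallest at
      \<open>t = 1 / V\<close>.\<close>
    have "(1 / V * cmod c)\<^sup>2 * V = (cmod c)\<^sup>2 / V"
      using V by (simp add: power2_eq_square)
    then have "0 \<le> (A_norm A u)\<^sup>2 - (cmod c)\<^sup>2 / V"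
      using quad[of "1 / V", folded V_def] by simp
    then show ?thesis
      using V by (simp add: V_def[symmetric] power_mult_distrib field_simps)
  qed
  then show ?thesis
    unfolding c_def by (rule power2_le_imp_le) (simp add: A_norm_nonneg)
qed

text \<open>Squaring the parallelism equation leaves only the cross term, the real part of
  \<open>cnj l * A_inner A x y\<close>, to compare with the product of the seminorms.\<close>

lemma A_parallel_iff_Cauchy_Schwarz_eq:
  "A_parallel A x y \<longleftrightarrow> cmod (A_inner A x y) = A_norm A x * A_norm A y"
proof
  assume "A_parallel A x y"
  then obtain l where l: "cmod l = 1" "A_norm A (x + l *\<^sub>C y) = A_norm A x + A_norm A y"
    by (auto simp: A_parallel_def)
  have "A_norm A x * A_norm A y = Re (cnj l * A_inner A x y)"
    using A_norm_add_scaleC_sq[of x l y] l by (simp add: power2_sum)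
  also have "\<dots> \<le> cmod (cnj l * A_inner A x y)"
    by (rule complex_Re_le_cmod)
  also have "\<dots> = cmod (A_inner A x y)"
    using l by (simp add: norm_mult)
  finally show "cmod (A_inner A x y) = A_norm A x * A_norm A y"
    using A_Cauchy_Schwarz[of x y] by linarith
next
  assume eq: "cmod (A_inner A x y) = A_norm A x * A_norm A y"
  define c where "c = A_inner A x y"
  \<comment> \<open>The phase of \<open>c\<close> rotates \<open>c\<close> onto its modulus. Since
    \<open>sgn 0 = 0\<close> is not unimodular, \<open>1\<close> is used when \<open>c\<close>
    vanishes.\<close>
  define l where "l = (if c = 0 then 1 else sgn c)"
  have l: "cmod l = 1" by (simp add: l_def norm_sgn)
  have "cnj l * c = of_real (cmod c)"
  proof (cases "c = 0")
    case False
    then show ?thesis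
      using complex_norm_square[of c]
      by (simp add: l_def sgn_eq power2_eq_square divide_simps mult.commute)
  qed (simp add: l_def)
  then have "(A_norm A (x + l *\<^sub>C y))\<^sup>2 = (A_norm A x + A_norm A y)\<^sup>2"
    using A_norm_add_scaleC_sq[of x l y] l eq by (simp add: c_def[symmetric] power2_sum)
  then have "A_norm A (x + l *\<^sub>C y) = A_norm A x + A_norm A y"
    by (rule power2_eq_imp_eq) (simp_all add: A_norm_nonneg)
  with l show "A_parallel A x y"
    by (auto simp: A_parallel_def)
qed

text \<open>Supplies the unit vectors at which numerical radii are attained; the last fact tracks
  the other vector when \<open>x\<close> is normalized.\<close>

lemma A_normalize:
  assumes "A_norm A u \<noteq> 0"
  obtains z where "A_norm A z = 1" and "cmod (A_inner A z u) = A_norm A u"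
    and "\<And>w. cmod (A_inner A z w) = cmod (A_inner A u w) / A_norm A u"
proof
  let ?z = "of_real (1 / A_norm A u) *\<^sub>C u"
  show "A_norm A ?z = 1"
    using assms A_norm_nonneg[of u] by (simp add: A_norm_scaleC norm_divide)
  show eq: "cmod (A_inner A ?z w) = cmod (A_inner A u w) / A_norm A u" for w
    using A_norm_nonneg[of u] by (simp add: A_inner_scaleC_left norm_mult norm_divide)
  show "cmod (A_inner A ?z u) = A_norm A u"
    unfolding eq using assms by (simp add: A_inner_self norm_power power2_eq_square norm_mult)
qed

text \<open>A vector of seminorm zero is killed by \<open>A\<close>: pairing \<open>u\<close> with
  \<open>A u\<close> under \<open>A_inner\<close> gives the squared norm of \<open>A u\<close>, and
  Cauchy-Schwarz makes it zero.\<close>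

lemma A_unit_vector_exists:
  assumes "A \<noteq> (\<lambda>_. 0)"
  shows "\<exists>z. A_norm A z = 1"
proof -
  obtain u where u: "A u \<noteq> 0" using assms by auto
  have "A_norm A u \<noteq> 0"
  proof
    assume "A_norm A u = 0"
    then have "cinner (A u) (A u) = 0"
      using A_Cauchy_Schwarz[of u "A u"] by (simp add: A_inner_def)
    with u show False by (simp add: cinner_eq_zero_iff)
  qed
  then show ?thesis using A_normalize by metis
qed

end

lemma cinner_Cauchy_Schwarz:
  "cmod (cinner u v) \<le> norm u * norm (v::'a::complex_hilbert_space)"
  using A_Cauchy_Schwarz[OF positive_op_ident, of u v]
  by (simp add: A_inner_def A_norm_def norm_eq_sqrt_cinner[of u] norm_eq_sqrt_cinner[of v])

section \<open>Rank one operators and their numerical radii\<close>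

context
  fixes A :: "'a::complex_hilbert_space \<Rightarrow> 'a"
  assumes pos: "positive_op A"
begin

lemma A_bounded_rank_one: "A_bounded A (A_rank_one A x y)"
proof -
  have bl: "bounded_linear A"
    using pos by (simp add: positive_op_def bounded_clinear_def)
  then obtain K where K: "\<And>z. norm (A z) \<le> norm z * K"
    using bounded_linear.bounded by blast
  have "bounded_linear (A_rank_one A x y)"
  proof (rule bounded_linear_intro)
    fix z w :: 'a and r :: real
    show "A_rank_one A x y (z + w) = A_rank_one A x y z + A_rank_one A x y w"
      by (simp add: A_rank_one_def A_inner_add_left[OF pos] scaleC_add_left)
    show "A_rank_one A x y (r *\<^sub>R z) = r *\<^sub>R A_rank_one A x y z"
      unfolding scaleC_of_real[symmetric]
      by (simp add: A_rank_one_def A_inner_scaleC_left[OF pos] scaleC_scaleC)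
    have "norm (A_rank_one A x y z) = cmod (cinner (A z) y) * norm x"
      by (simp add: A_rank_one_def A_inner_def norm_scaleC)
    also have "\<dots> \<le> norm (A z) * norm y * norm x"
      by (intro mult_right_mono cinner_Cauchy_Schwarz) auto
    also have "\<dots> \<le> norm z * K * norm y * norm x"
      by (intro mult_right_mono K) auto
    finally show "norm (A_rank_one A x y z) \<le> norm z * (K * norm y * norm x)"
      by (simp add: mult.assoc)
  qed
  moreover have "A_rank_one A x y (k *\<^sub>C z) = k *\<^sub>C A_rank_one A x y z" for k z
    by (simp add: A_rank_one_def A_inner_scaleC_left[OF pos] scaleC_scaleC)
  \<comment> \<open>The summand \<open>1\<close> keeps the constant strictly positive even if
    \<open>x\<close> or \<open>y\<close> has seminorm zero.\<close>
  moreover have "A_norm A (A_rank_one A x y z) \<le> (A_norm A x * A_norm A y + 1) * A_norm A z" for z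
    using mult_right_mono[OF A_Cauchy_Schwarz[OF pos, of z y] A_norm_nonneg[OF pos, of x]] A_norm_nonneg[OF pos, of z]
    by (simp add: A_rank_one_def A_norm_scaleC[OF pos] algebra_simps)
  moreover have "A_norm A x * A_norm A y + 1 > 0"
    using mult_nonneg_nonneg[OF A_norm_nonneg[OF pos, of x] A_norm_nonneg[OF pos, of y]] by linarith
  ultimately show ?thesis
    unfolding A_bounded_def bounded_clinear_def by blast
qed

lemma A_inner_rank_one_self:
  "A_inner A (A_rank_one A x x z) z = of_real ((cmod (A_inner A z x))\<^sup>2)"
  unfolding complex_norm_square
  by (simp add: A_rank_one_def A_inner_scaleC_left[OF pos] A_inner_commute[OF pos, of x z])

lemma A_inner_rank_one_combination:
  "A_inner A (A_rank_one A x x z + l *\<^sub>C A_rank_one A y y z) z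
    = of_real ((cmod (A_inner A z x))\<^sup>2) + l * of_real ((cmod (A_inner A z y))\<^sup>2)"
  by (simp only: A_inner_add_left[OF pos] A_inner_scaleC_left[OF pos] A_inner_rank_one_self)

lemma A_inner_unit_le:
  assumes "A_norm A z = 1"
  shows "cmod (A_inner A z x) \<le> A_norm A x"
  using A_Cauchy_Schwarz[OF pos, of z x] assms by simp

text \<open>All radii computed exactly below are attained, so a maximum replaces the
  supremum.\<close>

lemma A_numerical_radius_eqI:
  assumes "A \<noteq> (\<lambda>_. 0)"
    and "\<And>z. A_norm A z = 1 \<Longrightarrow> cmod (A_inner A (T z) z) \<le> r"
    and "\<exists>z. A_norm A z = 1 \<and> r \<le> cmod (A_inner A (T z) z)"
  shows "A_numerical_radius A T = r"
  unfolding A_numerical_radius_def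
proof (rule cSup_eq_maximum)
  show "r \<in> (\<lambda>z. cmod (A_inner A (T z) z)) ` {z. A_norm A z = 1}"
    using assms(2,3) by (fastforce intro: antisym)
qed (use assms(2) in auto)

lemma A_numerical_radius_rank_one:
  assumes "A \<noteq> (\<lambda>_. 0)"
  shows "A_numerical_radius A (A_rank_one A x x) = (A_norm A x)\<^sup>2"
proof (rule A_numerical_radius_eqI[OF assms])
  show "cmod (A_inner A (A_rank_one A x x z) z) \<le> (A_norm A x)\<^sup>2" if "A_norm A z = 1" for z
    unfolding A_inner_rank_one_self using A_inner_unit_le[OF that]
    by (simp add: norm_power power_mono)
  show "\<exists>z. A_norm A z = 1 \<and> (A_norm A x)\<^sup>2 \<le> cmod (A_inner A (A_rank_one A x x z) z)"
  proof (cases "A_norm A x = 0")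
    case True
    then show ?thesis using A_unit_vector_exists[OF pos assms] by auto
  next
    case False
    then obtain z where "A_norm A z = 1" "cmod (A_inner A z x) = A_norm A x"
      by (metis A_normalize[OF pos])
    then show ?thesis
      by (intro exI[of _ z]) (simp add: A_inner_rank_one_self norm_power)
  qed
qed

section \<open>Numerical radius parallelism as equality in Cauchy-Schwarz\<close>

lemma A_inner_sq_sum_le:
  assumes z: "A_norm A z = 1"
  shows "((cmod (A_inner A z x))\<^sup>2 + (cmod (A_inner A z y))\<^sup>2)\<^sup>2
    \<le> (A_norm A x)^4 + (A_norm A y)^4 + 2 * (A_norm A x * A_norm A y * cmod (A_inner A x y))"
proof -
  define p q where "p = A_inner A z x" and "q = A_inner A z y"
  define w where "w = p *\<^sub>C x + q *\<^sub>C y"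
  have p: "cmod p \<le> A_norm A x" and q: "cmod q \<le> A_norm A y"
    unfolding p_def q_def using A_inner_unit_le[OF z] by auto
  have "A_inner A w z = of_real ((cmod p)\<^sup>2 + (cmod q)\<^sup>2)"
    unfolding of_real_add complex_norm_square
    by (simp add: w_def A_inner_sesquilinear[OF pos] p_def q_def A_inner_commute[OF pos, of x z]
        A_inner_commute[OF pos, of y z])
  then have "(cmod p)\<^sup>2 + (cmod q)\<^sup>2 = cmod (A_inner A w z)"
    by (metis norm_of_real abs_of_nonneg sum_power2_ge_zero)
  also have "\<dots> \<le> A_norm A w"
    using A_Cauchy_Schwarz[OF pos, of w z] z by simp
  finally have "((cmod p)\<^sup>2 + (cmod q)\<^sup>2)\<^sup>2 \<le> (A_norm A w)\<^sup>2"
    by (rule power_mono) simp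
  \<comment> \<open>Expanding the seminorm of the whole combination \<open>w\<close> is what brings
    in \<open>A_inner A x y\<close>.\<close>
  also have "\<dots> = (cmod p)\<^sup>2 * (A_norm A x)\<^sup>2 + (cmod q)\<^sup>2 * (A_norm A y)\<^sup>2
      + 2 * Re (cnj q * (p * A_inner A x y))"
    unfolding w_def A_norm_add_scaleC_sq[OF pos]
    by (simp add: A_norm_scaleC[OF pos] A_inner_scaleC_left[OF pos] power_mult_distrib)
  also have "\<dots> \<le> (A_norm A x)\<^sup>2 * (A_norm A x)\<^sup>2 + (A_norm A y)\<^sup>2 * (A_norm A y)\<^sup>2
      + 2 * (A_norm A x * A_norm A y * cmod (A_inner A x y))"
  proof (intro add_mono mult_right_mono mult_left_mono)
    have "Re (cnj q * (p * A_inner A x y)) \<le> cmod (cnj q * (p * A_inner A x y))"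
      by (rule complex_Re_le_cmod)
    also have "\<dots> = cmod p * cmod q * cmod (A_inner A x y)"
      by (simp add: norm_mult)
    also have "\<dots> \<le> A_norm A x * A_norm A y * cmod (A_inner A x y)"
      by (intro mult_right_mono mult_mono p q) (simp_all add: A_norm_nonneg[OF pos])
    finally show "Re (cnj q * (p * A_inner A x y))
        \<le> A_norm A x * A_norm A y * cmod (A_inner A x y)" .
  qed (use p q in \<open>auto intro: power_mono\<close>)
  finally show ?thesis
    by (simp add: p_def q_def power2_eq_square power4_eq_xxxx mult.assoc)
qed

lemma cmod_rank_one_combination_le:
  assumes "cmod l = 1"
  shows "cmod (A_inner A (A_rank_one A x x z + l *\<^sub>C A_rank_one A y y z) z)
    \<le> (cmod (A_inner A z x))\<^sup>2 + (cmod (A_inner A z y))\<^sup>2"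
proof -
  have "cmod (of_real r + l * of_real s) \<le> r + s" if "0 \<le> r" "0 \<le> s" for r s :: real
    using norm_triangle_ineq[of "of_real r" "l * of_real s"] assms that by (simp add: norm_mult)
  then show ?thesis
    unfolding A_inner_rank_one_combination by (meson zero_le_power2)
qed

lemma A_numerical_radius_parallel_rank_one_iff:
  assumes nz: "A \<noteq> (\<lambda>_. 0)"
  shows "A_numerical_radius_parallel A (A_rank_one A x x) (A_rank_one A y y)
    \<longleftrightarrow> cmod (A_inner A x y) = A_norm A x * A_norm A y"
proof
  define M where "M = (A_norm A x)^4 + (A_norm A y)^4
    + 2 * (A_norm A x * A_norm A y * cmod (A_inner A x y))"
  assume "A_numerical_radius_parallel A (A_rank_one A x x) (A_rank_one A y y)"
  then obtain l where l: "cmod l = 1"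
    and "A_numerical_radius A (\<lambda>z. A_rank_one A x x z + l *\<^sub>C A_rank_one A y y z)
      = (A_norm A x)\<^sup>2 + (A_norm A y)\<^sup>2"
    by (auto simp: A_numerical_radius_parallel_def A_numerical_radius_rank_one[OF nz])
  moreover have "A_numerical_radius A (\<lambda>z. A_rank_one A x x z + l *\<^sub>C A_rank_one A y y z) \<le> sqrt M"
    unfolding A_numerical_radius_def
  proof (rule cSUP_least)
    show "{z. A_norm A z = 1} \<noteq> {}" using A_unit_vector_exists[OF pos nz] by auto
    fix z assume "z \<in> {z. A_norm A z = 1}"
    then have "(cmod (A_inner A z x))\<^sup>2 + (cmod (A_inner A z y))\<^sup>2 \<le> sqrt M"
      using A_inner_sq_sum_le[of z x y] by (auto simp: M_def intro: real_le_rsqrt)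
    then show "cmod (A_inner A (A_rank_one A x x z + l *\<^sub>C A_rank_one A y y z) z) \<le> sqrt M"
      using cmod_rank_one_combination_le[OF l] order_trans by blast
  qed
  ultimately have "(A_norm A x)\<^sup>2 + (A_norm A y)\<^sup>2 \<le> sqrt M" by simp
  then have "((A_norm A x)\<^sup>2 + (A_norm A y)\<^sup>2)\<^sup>2 \<le> M"
    by (rule sqrt_ge_absD[OF order_trans[rotated]]) simp
  \<comment> \<open>The fourth powers on both sides cancel, leaving twice the squared product
    against the cross term of \<open>M\<close>.\<close>
  then have "(A_norm A x * A_norm A y) * (A_norm A x * A_norm A y)
      \<le> (A_norm A x * A_norm A y) * cmod (A_inner A x y)"
    by (simp add: M_def power2_eq_square power4_eq_xxxx algebra_simps)
  moreover have "0 \<le> A_norm A x * A_norm A y"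
    by (simp add: A_norm_nonneg[OF pos])
  \<comment> \<open>Cancel the product if it is positive; if it is zero, the bound is
    trivial.\<close>
  ultimately have "A_norm A x * A_norm A y \<le> cmod (A_inner A x y)"
    by (metis mult_left_le_imp_le norm_ge_zero order_le_less)
  then show "cmod (A_inner A x y) = A_norm A x * A_norm A y"
    using A_Cauchy_Schwarz[OF pos, of x y] by linarith
next
  assume eq: "cmod (A_inner A x y) = A_norm A x * A_norm A y"
  \<comment> \<open>The scalar \<open>1\<close> works because both quadratic forms are nonnegative,
    so their moduli add without loss.\<close>
  have "A_numerical_radius A (\<lambda>z. A_rank_one A x x z + 1 *\<^sub>C A_rank_one A y y z)
      = (A_norm A x)\<^sup>2 + (A_norm A y)\<^sup>2"
  proof (rule A_numerical_radius_eqI[OF nz])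
    fix z assume "A_norm A z = 1"
    then have "(cmod (A_inner A z x))\<^sup>2 + (cmod (A_inner A z y))\<^sup>2 \<le> (A_norm A x)\<^sup>2 + (A_norm A y)\<^sup>2"
      by (intro add_mono power_mono A_inner_unit_le) auto
    then show "cmod (A_inner A (A_rank_one A x x z + 1 *\<^sub>C A_rank_one A y y z) z)
        \<le> (A_norm A x)\<^sup>2 + (A_norm A y)\<^sup>2"
      using cmod_rank_one_combination_le[of 1 x z y] by simp
  next
    have val: "cmod (A_inner A (A_rank_one A x x z + 1 *\<^sub>C A_rank_one A y y z) z)
        = (cmod (A_inner A z x))\<^sup>2 + (cmod (A_inner A z y))\<^sup>2" for z
      unfolding A_inner_rank_one_combination mult_1 of_real_add[symmetric] norm_of_real by simp
    show "\<exists>z. A_norm A z = 1 \<and> (A_norm A x)\<^sup>2 + (A_norm A y)\<^sup>2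
        \<le> cmod (A_inner A (A_rank_one A x x z + 1 *\<^sub>C A_rank_one A y y z) z)"
    proof (cases "A_norm A x = 0")
      case x0: True
      show ?thesis
      proof (cases "A_norm A y = 0")
        case True
        then show ?thesis using x0 A_unit_vector_exists[OF pos nz] by auto
      next
        case False
        then obtain z where "A_norm A z = 1" "cmod (A_inner A z y) = A_norm A y"
          by (metis A_normalize[OF pos])
        then show ?thesis
          unfolding val using x0 by (intro exI[of _ z]) simp
      qed
    next
      case False
      \<comment> \<open>By \<open>eq\<close> the last quotient is \<open>A_norm A y\<close>, so
        normalizing \<open>x\<close> maximises both forms at once.\<close>
      then obtain z where "A_norm A z = 1" "cmod (A_inner A z x) = A_norm A x"
        "cmod (A_inner A z y) = cmod (A_inner A x y) / A_norm A x"
        by (metis A_normalize[OF pos])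
      then show ?thesis
        unfolding val using False eq by (intro exI[of _ z]) simp
    qed
  qed
  then show "A_numerical_radius_parallel A (A_rank_one A x x) (A_rank_one A y y)"
    unfolding A_numerical_radius_parallel_def
    using A_bounded_rank_one A_numerical_radius_rank_one[OF nz]
    by (intro conjI exI[of _ 1]) auto
qed

end

theorem theorem2p11:
  fixes A :: "'a::complex_hilbert_space \<Rightarrow> 'a" and x y :: 'a
  assumes "positive_op A" and "A \<noteq> (\<lambda>_. 0)"
  shows "A_parallel A x y \<longleftrightarrow>
    A_numerical_radius_parallel A (A_rank_one A x x) (A_rank_one A y y)"
  using A_parallel_iff_Cauchy_Schwarz_eq[OF assms(1)]
    A_numerical_radius_parallel_rank_one_iff[OF assms] by simp

end
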